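(* Let $A\in\mathbb{R}^{n\times n}$, $B\in\mathbb{R}^{n\times m}$ with $(A,B)$ controllable, and let $T>0$. If $\ker(B^\top\widetilde{A}_T^\top)\cap\ker(B^\top)=\{0\}$, then the pair $\big(A_{d,T},\,[B_{d,T}\ \ B_{i,T}]\big)$ is controllable.
   Context: For $T>0$ define $\widetilde{A}_T:=\int_0^T e^{A\tau}\,d\tau$, $A_{d,T}:=e^{AT}$, $B_{d,T}:=\widetilde{A}_T B$, $B_{i,T}:=A_{d,T}B$. *)

theory Defs
  imports "HOL-Analysis.Analysis"
begin

text \<open>Matrix powers and the matrix exponential (as the usual power series).\<close>

primrec mat_pow :: "real^'n^'n \<Rightarrow> nat \<Rightarrow> real^'n^'n" where
  "mat_pow M 0 = mat 1"
| "mat_pow M (Suc k) = M ** mat_pow M k"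

definition mat_exp :: "real^'n^'n \<Rightarrow> real^'n^'n" where
  "mat_exp M = (\<Sum>k. (1 / (fact k :: real)) *\<^sub>R mat_pow M k)"

text \<open>Kalman controllability of the pair (A,B): the columns of
  [B, AB, ..., A^(n-1) B] span R^n, i.e. the controllability matrix has rank n.\<close>

definition controllable :: "real^'n^'n \<Rightarrow> real^'m^'n \<Rightarrow> bool" where
  "controllable A B \<longleftrightarrow>
     span (\<Union>k<CARD('n). range (\<lambda>u. (mat_pow A k ** B) *v u)) = UNIV"

text \<open>Horizontal concatenation [B1 B2] of two n x m matrices.\<close>

definition hcat :: "real^'m^'n \<Rightarrow> real^'p^'n \<Rightarrow> real^('m + 'p)^'n" where
  "hcat B1 B2 = (\<chi> i j. case j of Inl a \<Rightarrow> B1 $ i $ a | Inr b \<Rightarrow> B2 $ i $ b)"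

definition At_int :: "real^'n^'n \<Rightarrow> real \<Rightarrow> real^'n^'n" where
  "At_int A T = integral {0..T} (\<lambda>\<tau>. mat_exp (\<tau> *\<^sub>R A))"

definition Ad :: "real^'n^'n \<Rightarrow> real \<Rightarrow> real^'n^'n" where
  "Ad A T = mat_exp (T *\<^sub>R A)"

definition Bd :: "real^'n^'n \<Rightarrow> real^'m^'n \<Rightarrow> real \<Rightarrow> real^'m^'n" where
  "Bd A B T = At_int A T ** B"

definition Bi :: "real^'n^'n \<Rightarrow> real^'m^'n \<Rightarrow> real \<Rightarrow> real^'m^'n" where
  "Bi A B T = Ad A T ** B"

end

theory Submission
  imports Defs
begin

text \<open>Let D = exp(TA). The reachable space of the pair (D, [Bd Bi]) is a D-invariant subspace
  containing the columns of Bd and of Bi = D B. Since D is invertible (exp(M) exp(-M) = 1 by the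
  Cauchy product of the two exponential series), invariance gives D K = K for this subspace K,
  so K also contains the columns of B. The kernel condition says precisely that the columns of
  Bd and B together span the whole space.\<close>

lemma has_sum_antidiagonal_iff:
  fixes f :: "nat \<times> nat \<Rightarrow> 'a::{comm_monoid_add, topological_space}"
  shows "(f has_sum S) (UNIV \<times> UNIV) \<longleftrightarrow> ((\<lambda>(k, i). f (i, k - i)) has_sum S) (SIGMA k:UNIV. {..k})"
  by (rule has_sum_reindex_bij_witness[where i = "\<lambda>(k, i). (i, k - i)" and j = "\<lambda>(i, j). (i + j, i)"])
    auto

text \<open>The library's Cauchy_product_sums needs a real_normed_algebra; square matrices are not one
  here (the ring structure on vec is componentwise), so the product is taken as a bounded bilinear map.\<close>

lemma bilinear_Cauchy_product_sums:
  fixes a :: "nat \<Rightarrow> 'a::banach" and b :: "nat \<Rightarrow> 'b::banach"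
    and prod :: "'a \<Rightarrow> 'b \<Rightarrow> 'c::banach"
  assumes bb: "bounded_bilinear prod"
    and a: "summable (\<lambda>k. norm (a k))" and b: "summable (\<lambda>k. norm (b k))"
  shows "(\<lambda>k. \<Sum>i\<le>k. prod (a i) (b (k - i))) sums prod (suminf a) (suminf b)"
proof -
  interpret prod: bounded_bilinear prod by (fact bb)
  obtain K where K: "\<And>x y. norm (prod x y) \<le> norm x * norm y * K"
    using prod.bounded by (elim exE) auto
  let ?f = "\<lambda>(i, j). prod (a i) (b j)"
  have norms: "(\<lambda>(i, j). norm (a i) * norm (b j)) summable_on UNIV \<times> UNIV"
    by (rule abs_summable_summable, rule Infinite_Sum.abs_summable_on_Sigma_iff[THEN iffD2])
      (use a b in \<open>simp add: norm_mult abs_mult infsum_cmult_right' infsum_nonneg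
        summable_on_cmult_left summable_on_cmult_right norm_summable_imp_summable_on\<close>)
  have "norm (?f x) \<le> K * (case x of (i, j) \<Rightarrow> norm (a i) * norm (b j))" for x
    using K[of "a (fst x)" "b (snd x)"] by (cases x) (simp add: mult_ac)
  then have "(\<lambda>x. norm (?f x)) summable_on UNIV \<times> UNIV"
    by (intro summable_on_comparison_test[OF summable_on_cmult_right[OF norms]]) auto
  then have summable: "?f summable_on UNIV \<times> UNIV"
    by (rule abs_summable_summable)
  have has_sum_a: "(a has_sum suminf a) UNIV"
    using norm_summable_imp_has_sum[OF a summable_sums[OF summable_norm_cancel[OF a]]] .
  have has_sum_b: "(b has_sum suminf b) UNIV"
    using norm_summable_imp_has_sum[OF b summable_sums[OF summable_norm_cancel[OF b]]] .
  have product: "(?f has_sum prod (suminf a) (suminf b)) (UNIV \<times> UNIV)"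
  proof (rule has_sum_SigmaI[OF _ _ summable])
    show "((\<lambda>j. ?f (i, j)) has_sum prod (a i) (suminf b)) UNIV" for i
      using has_sum_bounded_linear[OF prod.bounded_linear_right has_sum_b] by simp
    show "((\<lambda>i. prod (a i) (suminf b)) has_sum prod (suminf a) (suminf b)) UNIV"
      using has_sum_bounded_linear[OF prod.bounded_linear_left has_sum_a] .
  qed
  have "((\<lambda>(k, i). prod (a i) (b (k - i))) has_sum prod (suminf a) (suminf b)) (SIGMA k:UNIV. {..k})"
    using has_sum_antidiagonal_iff[THEN iffD1, OF product] by simp
  then have "((\<lambda>k. \<Sum>i\<le>k. prod (a i) (b (k - i))) has_sum prod (suminf a) (suminf b)) UNIV"
    by (rule has_sum_SigmaD) simp
  then show ?thesis
    by (rule has_sum_imp_sums)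
qed

lemma matrix_add_rdistrib: "((A :: real^'n^'m) + B) ** C = A ** C + B ** C"
  by (simp add: matrix_matrix_mult_def vec_eq_iff distrib_right sum.distrib)

lemma matrix_uminus_mult: "(- (A :: real^'n^'m)) ** B = - (A ** B)"
  by (simp add: matrix_matrix_mult_def vec_eq_iff sum_negf)

lemma bounded_bilinear_matrix_matrix_mult:
  "bounded_bilinear ((**) :: real^'n^'m \<Rightarrow> real^'p^'n \<Rightarrow> real^'p^'m)"
proof -
  have "bilinear ((**) :: real^'n^'m \<Rightarrow> real^'p^'n \<Rightarrow> real^'p^'m)"
    by (auto intro!: linearI simp: bilinear_def matrix_add_ldistrib matrix_add_rdistrib
        scalar_matrix_assoc matrix_scalar_ac)
  then show ?thesis
    by (simp add: bilinear_conv_bounded_bilinear)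
qed

lemma mat_pow_add: "mat_pow M i ** mat_pow M j = mat_pow M (i + j)"
  by (induction i) (auto simp: matrix_mul_assoc[symmetric])

lemma mat_pow_uminus: "mat_pow (- M) k = ((-1) ^ k) *\<^sub>R mat_pow (M :: real^'n^'n) k"
  by (induction k) (simp_all add: matrix_uminus_mult matrix_scalar_ac scalar_matrix_assoc[symmetric])

lemma summable_norm_mat_exp_series:
  "summable (\<lambda>k. norm ((1 / fact k) *\<^sub>R mat_pow (M :: real^'n^'n) k))"
proof -
  obtain K where K: "K > 0" "\<And>(X :: real^'n^'n) (Y :: real^'n^'n). norm (X ** Y) \<le> norm X * norm Y * K"
    using bounded_bilinear.pos_bounded[OF bounded_bilinear_matrix_matrix_mult] by blast
  let ?c = "norm (mat 1 :: real^'n^'n)"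
  have bound: "norm (mat_pow M k) \<le> ?c * (norm M * K) ^ k" for k
  proof (induction k)
    case (Suc k)
    have "norm (mat_pow M (Suc k)) \<le> norm M * norm (mat_pow M k) * K"
      using K(2)[of M "mat_pow M k"] by simp
    also have "\<dots> \<le> norm M * (?c * (norm M * K) ^ k) * K"
      using Suc K(1) by (intro mult_right_mono mult_left_mono) auto
    finally show ?case
      by (simp add: algebra_simps)
  qed simp
  have "summable (\<lambda>k. ?c * (inverse (fact k) * (norm M * K) ^ k))"
    by (intro summable_mult summable_exp)
  then show ?thesis
    by (rule summable_comparison_test')
      (use bound in \<open>auto simp: field_simps intro!: divide_right_mono\<close>)
qed

lemma binomial_sum_alternating_fact:
  "(\<Sum>i\<le>k. 1 / fact i * (1 / fact (k - i)) * (-1) ^ (k - i) :: real) = (if k = 0 then 1 else 0)"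
proof -
  have "(\<Sum>i\<le>k. 1 / fact i * (1 / fact (k - i)) * (-1) ^ (k - i) :: real)
      = (\<Sum>i\<le>k. of_nat (k choose i) * 1 ^ i * (-1) ^ (k - i)) / fact k"
    by (simp add: sum_divide_distrib binomial_fact field_simps)
  also have "\<dots> = (1 + (-1)) ^ k / fact k"
    by (simp only: binomial_ring)
  finally show ?thesis
    by simp
qed

lemma mat_exp_mult_uminus: "mat_exp M ** mat_exp (- M) = (mat 1 :: real^'n^'n)"
proof -
  let ?a = "\<lambda>k. (1 / fact k) *\<^sub>R mat_pow (M :: real^'n^'n) k"
  let ?b = "\<lambda>k. (1 / fact k) *\<^sub>R mat_pow (- M :: real^'n^'n) k"
  have "(\<Sum>i\<le>k. ?a i ** ?b (k - i)) = (if k = 0 then mat 1 else 0)" for k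
  proof -
    have "(\<Sum>i\<le>k. ?a i ** ?b (k - i))
        = (\<Sum>i\<le>k. 1 / fact i * (1 / fact (k - i)) * (-1) ^ (k - i)) *\<^sub>R mat_pow M k"
      by (simp add: scaleR_sum_left mat_pow_uminus matrix_scalar_ac
          scalar_matrix_assoc[symmetric] mat_pow_add mult_ac)
    also have "\<dots> = (if k = 0 then 1 else 0) *\<^sub>R mat_pow M k"
      by (simp only: binomial_sum_alternating_fact)
    finally show ?thesis
      by simp
  qed
  moreover have "(\<lambda>k. \<Sum>i\<le>k. ?a i ** ?b (k - i)) sums (mat_exp M ** mat_exp (- M))"
    unfolding mat_exp_def
    by (rule bilinear_Cauchy_product_sums[OF bounded_bilinear_matrix_matrix_mult
          summable_norm_mat_exp_series summable_norm_mat_exp_series])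
  ultimately have "(\<lambda>k. if k = 0 then mat 1 else 0) sums (mat_exp M ** mat_exp (- M))"
    by simp
  moreover have "(\<lambda>k. if k = 0 then mat 1 else 0) sums (mat 1 :: real^'n^'n)"
    using sums_single[of 0 "\<lambda>_. mat 1 :: real^'n^'n"] by simp
  ultimately show ?thesis
    by (rule sums_unique2)
qed

lemma inj_mat_exp: "inj ((*v) (mat_exp (M :: real^'n^'n)))"
proof (rule injI)
  fix x y
  assume "mat_exp M *v x = mat_exp M *v y"
  then have "(mat_exp (- M) ** mat_exp M) *v x = (mat_exp (- M) ** mat_exp M) *v y"
    by (simp add: matrix_vector_mul_assoc[symmetric])
  then show "x = y"
    using mat_exp_mult_uminus[of "- M"] by simp
qed

definition krylov_space :: "real^'n^'n \<Rightarrow> real^'k^'n \<Rightarrow> nat \<Rightarrow> (real^'n) set" where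
  "krylov_space D H j = span (\<Union>k<j. range (\<lambda>u. (mat_pow D k ** H) *v u))"

lemma controllable_iff_krylov_space:
  fixes D :: "real^'n^'n" and H :: "real^'k^'n"
  shows "controllable D H \<longleftrightarrow> krylov_space D H CARD('n) = UNIV"
  by (simp add: controllable_def krylov_space_def)

lemma span_Un_span: "span (X \<union> span Y) = span (X \<union> Y)"
proof
  show "span (X \<union> span Y) \<subseteq> span (X \<union> Y)"
    by (intro span_minimal subspace_span Un_least)
      (auto intro: span_superset[THEN subsetD] span_mono[THEN subsetD])
qed (intro span_mono, auto intro: span_superset[THEN subsetD])

lemma krylov_space_Suc:
  "krylov_space D H (Suc j) = span (range ((*v) H) \<union> (*v) D ` krylov_space D H j)"
proof -
  let ?U = "\<Union>k<j. range (\<lambda>u. (mat_pow D k ** H) *v u)"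
  have "range (\<lambda>u. (mat_pow D (Suc k) ** H) *v u) = (*v) D ` range (\<lambda>u. (mat_pow D k ** H) *v u)"
    for k
    by (auto simp: image_image matrix_vector_mul_assoc matrix_mul_assoc)
  then have "krylov_space D H (Suc j) = span (range ((*v) H) \<union> (*v) D ` ?U)"
    by (simp add: krylov_space_def lessThan_Suc_eq_insert_0 image_UN)
  also have "\<dots> = span (range ((*v) H) \<union> span ((*v) D ` ?U))"
    by (rule span_Un_span[symmetric])
  finally show ?thesis
    by (simp add: krylov_space_def linear_span_image[OF matrix_vector_mul_linear])
qed

lemma krylov_space_mono: "krylov_space D H j \<subseteq> krylov_space D H (Suc j)"
  unfolding krylov_space_def by (intro span_mono UN_mono) auto

lemma krylov_space_stationary:
  assumes "krylov_space D H (Suc i) = krylov_space D H i" and "i \<le> m"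
  shows "krylov_space D H m = krylov_space D H i"
  using assms(2)
proof (induction m rule: dec_induct)
  case (step m)
  have "krylov_space D H (Suc m) = span (range ((*v) H) \<union> (*v) D ` krylov_space D H m)"
    by (rule krylov_space_Suc)
  also have "\<dots> = krylov_space D H (Suc i)"
    by (simp only: step.IH krylov_space_Suc)
  finally show ?case
    using assms(1) by simp
qed simp

lemma krylov_space_stabilizes:
  "\<exists>i\<le>CARD('n). krylov_space D H (Suc i) = (krylov_space D H i :: (real^'n) set)"
proof (rule ccontr)
  assume "\<not> ?thesis"
  then have "span (krylov_space D H i) \<subset> span (krylov_space D H (Suc i))" if "i \<le> CARD('n)" for i
    using krylov_space_mono[of D H i] that by (auto simp: krylov_space_def span_span)
  then have "j \<le> dim (krylov_space D H j)" if "j \<le> Suc CARD('n)" for j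
    using that
  proof (induction j)
    case (Suc j)
    then have "dim (krylov_space D H j) < dim (krylov_space D H (Suc j))"
      by (simp add: dim_psubset)
    with Suc show ?case
      by simp
  qed simp
  then have "Suc CARD('n) \<le> dim (krylov_space D H (Suc CARD('n)))"
    by simp
  then show False
    using dim_subset_UNIV_cart[of "krylov_space D H (Suc CARD('n))"] by simp
qed

lemma krylov_space_Suc_CARD:
  "krylov_space D H (Suc CARD('n)) = (krylov_space D H CARD('n) :: (real^'n) set)"
proof -
  obtain i where "i \<le> CARD('n)" "krylov_space D H (Suc i) = krylov_space D H i"
    using krylov_space_stabilizes by blast
  then show ?thesis
    using krylov_space_stationary[of D H i "CARD('n)"] krylov_space_stationary[of D H i "Suc CARD('n)"]
    by simp
qed

lemma krylov_space_CARD_invariant: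
  "(*v) D ` krylov_space D H CARD('n) \<subseteq> (krylov_space D H CARD('n) :: (real^'n) set)"
proof -
  have "(*v) D ` krylov_space D H CARD('n)
      \<subseteq> span (range ((*v) H) \<union> (*v) D ` krylov_space D H CARD('n))"
    by (rule subset_trans[OF Un_upper2 span_superset])
  then show ?thesis
    by (simp only: krylov_space_Suc[symmetric] krylov_space_Suc_CARD)
qed

lemma range_subset_krylov_space_CARD:
  "range ((*v) H) \<subseteq> (krylov_space D H CARD('n) :: (real^'n) set)"
proof -
  have "range ((*v) H) \<subseteq> span (range ((*v) H) \<union> (*v) D ` krylov_space D H CARD('n))"
    by (rule subset_trans[OF Un_upper1 span_superset])
  then show ?thesis
    by (simp only: krylov_space_Suc[symmetric] krylov_space_Suc_CARD)
qed

lemma linear_image_eq_if_inj_invariant: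
  fixes f :: "'a::euclidean_space \<Rightarrow> 'a"
  assumes "linear f" and "inj f" and "subspace S" and "f ` S \<subseteq> S"
  shows "f ` S = S"
proof (rule subspace_dim_equal)
  show "subspace (f ` S)"
    using assms(1,3) by (rule linear_subspace_image)
  show "dim S \<le> dim (f ` S)"
    using dim_image_eq[OF assms(1) inj_on_subset[OF assms(2)]] by simp
qed fact+

lemma sum_UNIV_Plus:
  "sum g (UNIV :: ('a::finite + 'b::finite) set) = sum (g \<circ> Inl) UNIV + sum (g \<circ> Inr) UNIV"
  by (metis UNIV_Plus_UNIV finite sum.Plus)

lemma range_hcat_left: "range ((*v) P) \<subseteq> range ((*v) (hcat P Q))"
proof
  fix y
  assume "y \<in> range ((*v) P)"
  then obtain v where "y = P *v v"
    by blast
  moreover have "hcat P Q *v (\<chi> j. case j of Inl a \<Rightarrow> v $ a | Inr b \<Rightarrow> 0) = P *v v"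
    by (simp add: hcat_def matrix_vector_mult_def vec_eq_iff sum_UNIV_Plus o_def)
  ultimately show "y \<in> range ((*v) (hcat P Q))"
    by (metis rangeI)
qed

lemma range_hcat_right: "range ((*v) Q) \<subseteq> range ((*v) (hcat P Q))"
proof
  fix y
  assume "y \<in> range ((*v) Q)"
  then obtain v where "y = Q *v v"
    by blast
  moreover have "hcat P Q *v (\<chi> j. case j of Inl a \<Rightarrow> 0 | Inr b \<Rightarrow> v $ b) = Q *v v"
    by (simp add: hcat_def matrix_vector_mult_def vec_eq_iff sum_UNIV_Plus o_def)
  ultimately show "y \<in> range ((*v) (hcat P Q))"
    by (metis rangeI)
qed

lemma transpose_mult_eq_0_if_orthogonal_range:
  fixes M :: "real^'m^'n"
  assumes "\<And>v. x \<bullet> (M *v v) = 0"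
  shows "transpose M *v x = 0"
proof -
  have "(x v* M) \<bullet> v = 0" for v
    using assms by (simp add: dot_lmul_matrix)
  then have "x v* M = 0"
    by (metis inner_eq_zero_iff)
  then show ?thesis
    by simp
qed

lemma span_ranges_eq_UNIV_if_kernels_trivial:
  fixes P :: "real^'m^'n" and Q :: "real^'p^'n"
  assumes "{x. transpose P *v x = 0} \<inter> {x. transpose Q *v x = 0} = {0}"
  shows "span (range ((*v) P) \<union> range ((*v) Q)) = UNIV"
proof (rule ccontr)
  assume "span (range ((*v) P) \<union> range ((*v) Q)) \<noteq> UNIV"
  then obtain x where "x \<noteq> 0" and orthogonal: "\<forall>y \<in> span (range ((*v) P) \<union> range ((*v) Q)). x \<bullet> y = 0"
    using span_not_UNIV_orthogonal by blast
  have "transpose P *v x = 0"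
    by (rule transpose_mult_eq_0_if_orthogonal_range) (use orthogonal in \<open>blast intro: span_base\<close>)
  moreover have "transpose Q *v x = 0"
    by (rule transpose_mult_eq_0_if_orthogonal_range) (use orthogonal in \<open>blast intro: span_base\<close>)
  ultimately show False
    using assms \<open>x \<noteq> 0\<close> by blast
qed

lemma controllable_hcat_mult:
  fixes D :: "real^'n^'n" and P :: "real^'m^'n" and Q :: "real^'p^'n"
  assumes inj: "inj ((*v) D)" and span: "span (range ((*v) P) \<union> range ((*v) Q)) = UNIV"
  shows "controllable D (hcat P (D ** Q))"
proof -
  let ?K = "krylov_space D (hcat P (D ** Q)) CARD('n)"
  have subspace: "subspace ?K"
    by (simp add: krylov_space_def subspace_span)
  have range_hcat: "range ((*v) (hcat P (D ** Q))) \<subseteq> ?K"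
    by (rule range_subset_krylov_space_CARD)
  have "(*v) D ` range ((*v) Q) \<subseteq> (*v) D ` ?K"
  proof -
    have "(*v) D ` range ((*v) Q) = range ((*v) (D ** Q))"
      by (auto simp: image_image matrix_vector_mul_assoc)
    also have "\<dots> \<subseteq> (*v) D ` ?K"
      using range_hcat_right range_hcat
        linear_image_eq_if_inj_invariant[OF matrix_vector_mul_linear inj subspace krylov_space_CARD_invariant]
      by blast
    finally show ?thesis .
  qed
  then have "range ((*v) Q) \<subseteq> ?K"
    using inj by (simp add: inj_image_subset_iff)
  moreover have "range ((*v) P) \<subseteq> ?K"
    using range_hcat_left range_hcat by blast
  ultimately have "span (range ((*v) P) \<union> range ((*v) Q)) \<subseteq> ?K"
    using subspace by (intro span_minimal) auto
  then show ?thesis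
    by (auto simp: controllable_iff_krylov_space span)
qed

theorem mainTheorem2:
  fixes A :: "real^'n^'n" and B :: "real^'m^'n" and T :: real
  assumes "controllable A B"
    and "T > 0"
    and "{x. (transpose B ** transpose (At_int A T)) *v x = 0} \<inter> {x. transpose B *v x = 0} = {0}"
  shows "controllable (Ad A T) (hcat (Bd A B T) (Bi A B T))"
proof -
  have "transpose B ** transpose (At_int A T) = transpose (Bd A B T)"
    by (simp add: Bd_def matrix_transpose_mul)
  then have "span (range ((*v) (Bd A B T)) \<union> range ((*v) B)) = UNIV"
    using assms(3) by (intro span_ranges_eq_UNIV_if_kernels_trivial) simp
  moreover have "inj ((*v) (Ad A T))"
    by (simp add: Ad_def inj_mat_exp)
  ultimately show ?thesis
    unfolding Bi_def by (rule controllable_hcat_mult[rotated])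
qed

end
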